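(* Let $S$ be the unilateral shift $(Sf)(z)=zf(z)$ on the Hardy space $H^2$ and let $Q\in\mathcal{B}(H^2)$. The following are equivalent. (i) $Q^2=S^2$. (ii) There is a $2\times 2$ constant unitary matrix $U$ and functions $a,b,c\in H^\infty$ satisfying $z a^2+bc=1$ (identically on $\mathbb{D}$) such that $$Q=W^{*}U^{*}\begin{bmatrix} za & b\\ zc & -za\end{bmatrix}UW.$$
   Context: $H^2$ is the Hardy space of the open unit disc $\mathbb{D}$, $H^\infty$ the algebra of bounded analytic functions on $\mathbb{D}$, and $\mathcal{B}(\mathcal{H})$ the bounded linear operators on a Hilbert space $\mathcal{H}$. $W:H^2\to H^2\oplus H^2$ is the unitary operator sending $g(z)=\sum_{n\ge 0}a_nz^n$ to the column $\begin{bmatrix}\sum_{k\ge 0}a_{2k}z^k\\ \sum_{k\ge 0}a_{2k+1}z^k\end{bmatrix}$; its adjoint is $W^*\begin{bmatrix} g_1 \\ g_2 \end{bmatrix}=g_1(z^2)+zg_2(z^2)$. A $2\times2$ matrix with entries in $H^\infty$ (in particular a constant matrix) is regarded as a bounded operator on $H^2\oplus H^2$ acting by matrix multiplication on columns: $\begin{bmatrix}\Phi_{11}&\Phi_{12}\\ \Phi_{21}&\Phi_{22}\end{bmatrix}\begin{bmatrix} g_1 \\ g_2 \end{bmatrix}=\begin{bmatrix}\Phi_{11}g_1+\Phi_{12}g_2\\ \Phi_{21}g_1+\Phi_{22}g_2\end{bmatrix}$. *)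

theory Defs
  imports "HOL-Complex_Analysis.Complex_Analysis"
begin

text \<open>
  Functions on the open unit disc are total functions that vanish outside the disc, so that
  equality of functions on the disc is equality in HOL.
\<close>

abbreviation unit_disc :: "complex set" where
  "unit_disc \<equiv> ball 0 1"

definition taylor_coeff :: "(complex \<Rightarrow> complex) \<Rightarrow> nat \<Rightarrow> complex" where
  "taylor_coeff f n = (deriv ^^ n) f 0 / fact n"

definition H2 :: "(complex \<Rightarrow> complex) set" where
  "H2 = {f. f holomorphic_on unit_disc \<and> (\<forall>z. z \<notin> unit_disc \<longrightarrow> f z = 0) \<and>
            summable (\<lambda>n. (cmod (taylor_coeff f n))\<^sup>2)}"

definition H2_inner :: "(complex \<Rightarrow> complex) \<Rightarrow> (complex \<Rightarrow> complex) \<Rightarrow> complex" where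
  "H2_inner f g = (\<Sum>n. taylor_coeff f n * cnj (taylor_coeff g n))"

definition H2_norm :: "(complex \<Rightarrow> complex) \<Rightarrow> real" where
  "H2_norm f = sqrt (\<Sum>n. (cmod (taylor_coeff f n))\<^sup>2)"

definition Hinf :: "(complex \<Rightarrow> complex) set" where
  "Hinf = {f. f holomorphic_on unit_disc \<and> (\<forall>z. z \<notin> unit_disc \<longrightarrow> f z = 0) \<and>
              bounded (f ` unit_disc)}"

text \<open>
  Operators are HOL functions of which only the values on \<open>H2\<close> matter; two operators are equal
  if they agree on \<open>H2\<close>.
\<close>

definition bounded_operator_H2 :: "((complex \<Rightarrow> complex) \<Rightarrow> (complex \<Rightarrow> complex)) \<Rightarrow> bool" where
  "bounded_operator_H2 T \<longleftrightarrow>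
     (\<forall>f\<in>H2. T f \<in> H2) \<and>
     (\<forall>f\<in>H2. \<forall>g\<in>H2. T (\<lambda>z. f z + g z) = (\<lambda>z. T f z + T g z)) \<and>
     (\<forall>c. \<forall>f\<in>H2. T (\<lambda>z. c * f z) = (\<lambda>z. c * T f z)) \<and>
     (\<exists>K. \<forall>f\<in>H2. H2_norm (T f) \<le> K * H2_norm f)"

definition shift :: "(complex \<Rightarrow> complex) \<Rightarrow> (complex \<Rightarrow> complex)" where
  "shift f = (\<lambda>z. z * f z)"

text \<open>
  A column of two functions is encoded as a single function with values in \<open>complex^2\<close>, and a
  matrix of functions as a single function with values in \<open>complex^2^2\<close>.
\<close>

definition H2_sq :: "(complex \<Rightarrow> complex^2) set" where
  "H2_sq = {G. \<forall>i. (\<lambda>z. G z $ i) \<in> H2}"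

definition H2_sq_inner :: "(complex \<Rightarrow> complex^2) \<Rightarrow> (complex \<Rightarrow> complex^2) \<Rightarrow> complex" where
  "H2_sq_inner F G = (\<Sum>i\<in>UNIV. H2_inner (\<lambda>z. F z $ i) (\<lambda>z. G z $ i))"

definition matrix_op ::
    "(complex \<Rightarrow> complex^2^2) \<Rightarrow> (complex \<Rightarrow> complex^2) \<Rightarrow> (complex \<Rightarrow> complex^2)" where
  "matrix_op \<Phi> G = (\<lambda>z. \<Phi> z *v G z)"

definition adjoint_matrix :: "complex^2^2 \<Rightarrow> complex^2^2" where
  "adjoint_matrix A = (\<chi> i j. cnj (A $ j $ i))"

definition unitary_matrix :: "complex^2^2 \<Rightarrow> bool" where
  "unitary_matrix U \<longleftrightarrow> adjoint_matrix U ** U = mat 1 \<and> U ** adjoint_matrix U = mat 1"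

definition W :: "(complex \<Rightarrow> complex) \<Rightarrow> (complex \<Rightarrow> complex^2)" where
  "W g = (\<lambda>z. if z \<in> unit_disc
              then vector [\<Sum>k. taylor_coeff g (2 * k) * z ^ k,
                           \<Sum>k. taylor_coeff g (2 * k + 1) * z ^ k]
              else 0)"

definition W_adj :: "(complex \<Rightarrow> complex^2) \<Rightarrow> (complex \<Rightarrow> complex)" where
  "W_adj G = (\<lambda>z. G (z\<^sup>2) $ 1 + z * G (z\<^sup>2) $ 2)"

lemma taylor_coeff_sums:
  assumes "f holomorphic_on unit_disc" "z \<in> unit_disc"
  shows "(\<lambda>n. taylor_coeff f n * z ^ n) sums f z"
  using holomorphic_power_series[OF assms] by (simp add: taylor_coeff_def)

lemma taylor_coeff_eqI:
  assumes "\<And>z. z \<in> unit_disc \<Longrightarrow> (\<lambda>n. c n * z ^ n) sums f z"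
  shows "taylor_coeff f n = c n"
proof -
  have "f has_fps_expansion Abs_fps c"
  proof (rule has_fps_expansionI)
    show "eventually (\<lambda>u. (\<lambda>n. fps_nth (Abs_fps c) n * u ^ n) sums f u) (nhds 0)"
      using assms by (auto simp: eventually_nhds intro!: exI[of _ unit_disc])
  qed
  from fps_nth_fps_expansion[OF this, of n] show ?thesis
    by (simp add: taylor_coeff_def)
qed

lemma H2_I:
  assumes "\<And>z. z \<in> unit_disc \<Longrightarrow> (\<lambda>n. c n * z ^ n) sums f z"
    and "\<And>z. z \<notin> unit_disc \<Longrightarrow> f z = 0"
    and "summable (\<lambda>n. (cmod (c n))\<^sup>2)"
  shows "f \<in> H2"
proof -
  have "f holomorphic_on unit_disc"
    using power_series_holomorphic[of 0 1 c f] assms(1) by auto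
  moreover have "taylor_coeff f = c"
    using taylor_coeff_eqI[OF assms(1)] by blast
  ultimately show ?thesis
    using assms(2,3) by (simp add: H2_def)
qed

lemma summable_square_imp_summable_powser:
  fixes c :: "nat \<Rightarrow> complex"
  assumes "summable (\<lambda>n. (cmod (c n))\<^sup>2)" "z \<in> unit_disc"
  shows "summable (\<lambda>n. c n * z ^ n)"
proof -
  have "(\<lambda>n. (cmod (c n))\<^sup>2) \<longlonglongrightarrow> 0"
    using assms(1) by (rule summable_LIMSEQ_zero)
  then have "eventually (\<lambda>n. (cmod (c n))\<^sup>2 < 1) sequentially"
    by (rule order_tendstoD) simp
  then have "eventually (\<lambda>n. norm (c n * z ^ n) \<le> cmod z ^ n) sequentially"
  proof eventually_elim
    case (elim n)
    then have "cmod (c n) \<le> 1"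
      by (smt (verit) one_le_power)
    then show ?case
      by (simp add: norm_mult norm_power mult_left_le_one_le)
  qed
  moreover have "summable (\<lambda>n. cmod z ^ n)"
    using assms(2) by (intro summable_geometric) simp
  ultimately show ?thesis
    by (rule summable_comparison_test_ev)
qed

lemma sums_interleave:
  fixes p q :: "nat \<Rightarrow> 'a::real_normed_vector"
  assumes "p sums x" "q sums y"
  shows "(\<lambda>n. if even n then p (n div 2) else q (n div 2)) sums (x + y)"
proof -
  have "(\<lambda>n. if even n then p (n div 2) else 0) sums x"
    using sums_mono_reindex[of "\<lambda>n. 2 * n" "\<lambda>n. if even n then p (n div 2) else 0" x] assms(1)
    by (force simp: strict_mono_def image_iff elim: evenE)
  moreover have "(\<lambda>n. if even n then 0 else q (n div 2)) sums y"
    using sums_mono_reindex[of "\<lambda>n. 2 * n + 1" "\<lambda>n. if even n then 0 else q (n div 2)" y] assms(2)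
    by (force simp: strict_mono_def image_iff elim: oddE)
  ultimately have "(\<lambda>n. (if even n then p (n div 2) else 0) + (if even n then 0 else q (n div 2)))
                     sums (x + y)"
    by (rule sums_add)
  then show ?thesis
    by (rule back_subst[where P = "\<lambda>h. h sums (x + y)"]) auto
qed

lemma summable_even_odd:
  fixes h :: "nat \<Rightarrow> real"
  assumes "summable h" "\<And>n. h n \<ge> 0"
  shows "summable (\<lambda>k. h (2 * k))" "summable (\<lambda>k. h (Suc (2 * k)))"
proof -
  show "summable (\<lambda>k. h (2 * k))"
    using summable_reindex[of h "\<lambda>k. 2 * k"] assms by (simp add: o_def inj_on_def)
  show "summable (\<lambda>k. h (Suc (2 * k)))"
    using summable_reindex[of h "\<lambda>k. Suc (2 * k)"] assms by (simp add: o_def inj_on_def)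
qed

lemma H2_D:
  assumes "f \<in> H2"
  shows "f holomorphic_on unit_disc" "z \<notin> unit_disc \<Longrightarrow> f z = 0"
    "summable (\<lambda>n. (cmod (taylor_coeff f n))\<^sup>2)"
  using assms by (auto simp: H2_def)

lemma H2_eqI:
  assumes "f \<in> H2" "g \<in> H2" "\<And>n. taylor_coeff f n = taylor_coeff g n"
  shows "f = g"
proof
  fix z
  show "f z = g z"
  proof (cases "z \<in> unit_disc")
    case True
    then show ?thesis
      using taylor_coeff_sums[OF H2_D(1)[OF assms(1)] True]
        taylor_coeff_sums[OF H2_D(1)[OF assms(2)] True] assms(3)
      by (simp add: sums_unique2)
  next
    case False
    then show ?thesis
      using H2_D(2)[OF assms(1)] H2_D(2)[OF assms(2)] by simp
  qed
qed

lemma H2_inner_summable: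
  assumes "f \<in> H2" "g \<in> H2"
  shows "summable (\<lambda>n. taylor_coeff f n * cnj (taylor_coeff g n))"
proof (rule summable_comparison_test')
  show "summable (\<lambda>n. (cmod (taylor_coeff f n))\<^sup>2 + (cmod (taylor_coeff g n))\<^sup>2)"
    using assms by (intro summable_add H2_D(3))
  show "norm (taylor_coeff f n * cnj (taylor_coeff g n))
          \<le> (cmod (taylor_coeff f n))\<^sup>2 + (cmod (taylor_coeff g n))\<^sup>2" for n
  proof -
    have "x * y \<le> x\<^sup>2 + y\<^sup>2" if "x \<ge> 0" "y \<ge> 0" for x y :: real
      using sum_squares_bound[of x y] mult_nonneg_nonneg[OF that] by linarith
    then show ?thesis
      by (simp add: norm_mult)
  qed
qed

lemma W_sums:
  assumes "f \<in> H2" "z \<in> unit_disc"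
  shows "(\<lambda>k. taylor_coeff f (2 * k) * z ^ k) sums (W f z $ 1)"
    "(\<lambda>k. taylor_coeff f (2 * k + 1) * z ^ k) sums (W f z $ 2)"
  using summable_even_odd[OF H2_D(3)[OF assms(1)]] assms(2)
    summable_square_imp_summable_powser[of "\<lambda>k. taylor_coeff f (2 * k)" z]
    summable_square_imp_summable_powser[of "\<lambda>k. taylor_coeff f (2 * k + 1)" z]
  by (simp_all add: W_def summable_sums)

lemma taylor_coeff_W:
  assumes "f \<in> H2"
  shows "taylor_coeff (\<lambda>z. W f z $ 1) k = taylor_coeff f (2 * k)"
    "taylor_coeff (\<lambda>z. W f z $ 2) k = taylor_coeff f (2 * k + 1)"
  using taylor_coeff_eqI[OF W_sums(1)[OF assms]] taylor_coeff_eqI[OF W_sums(2)[OF assms]]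
  by blast+

lemma W_in_H2_sq:
  assumes "f \<in> H2"
  shows "W f \<in> H2_sq"
proof -
  have "(\<lambda>z. W f z $ 1) \<in> H2"
    by (rule H2_I[OF W_sums(1)[OF assms]])
      (use summable_even_odd[OF H2_D(3)[OF assms]] in \<open>auto simp: W_def\<close>)
  moreover have "(\<lambda>z. W f z $ 2) \<in> H2"
    by (rule H2_I[OF W_sums(2)[OF assms]])
      (use summable_even_odd[OF H2_D(3)[OF assms]] in \<open>auto simp: W_def\<close>)
  ultimately show ?thesis
    by (simp add: H2_sq_def forall_2)
qed

lemma W_adj_sums:
  assumes "G \<in> H2_sq" "z \<in> unit_disc"
  shows "(\<lambda>n. (if even n then taylor_coeff (\<lambda>z. G z $ 1) (n div 2)
                          else taylor_coeff (\<lambda>z. G z $ 2) (n div 2)) * z ^ n) sums W_adj G z"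
proof -
  have G: "(\<lambda>z. G z $ i) \<in> H2" for i
    using assms(1) by (simp add: H2_sq_def)
  have z2: "z\<^sup>2 \<in> unit_disc"
    using assms(2) by (simp add: norm_power power_less_one_iff)
  have "(\<lambda>n. if even n then taylor_coeff (\<lambda>z. G z $ 1) (n div 2) * (z\<^sup>2) ^ (n div 2)
              else z * (taylor_coeff (\<lambda>z. G z $ 2) (n div 2) * (z\<^sup>2) ^ (n div 2)))
          sums (G (z\<^sup>2) $ 1 + z * G (z\<^sup>2) $ 2)"
    by (intro sums_interleave sums_mult taylor_coeff_sums[OF H2_D(1)[OF G] z2])
  moreover have "(if even n then p * (z\<^sup>2) ^ (n div 2) else z * (q * (z\<^sup>2) ^ (n div 2)))
                   = (if even n then p else q) * z ^ n" for n p q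
    by (auto elim!: evenE oddE simp: power_mult)
  ultimately show ?thesis
    by (simp add: W_adj_def)
qed

lemma taylor_coeff_W_adj:
  assumes "G \<in> H2_sq"
  shows "taylor_coeff (W_adj G) n =
           (if even n then taylor_coeff (\<lambda>z. G z $ 1) (n div 2)
            else taylor_coeff (\<lambda>z. G z $ 2) (n div 2))"
  by (rule taylor_coeff_eqI) (rule W_adj_sums[OF assms])

lemma W_adj_in_H2:
  assumes "G \<in> H2_sq"
  shows "W_adj G \<in> H2"
proof (rule H2_I[OF W_adj_sums[OF assms]])
  have G: "(\<lambda>z. G z $ i) \<in> H2" for i
    using assms by (simp add: H2_sq_def)
  show "W_adj G z = 0" if "z \<notin> unit_disc" for z
  proof -
    have "z\<^sup>2 \<notin> unit_disc"
      using that by (simp add: norm_power not_less one_le_power)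
    then show ?thesis
      using H2_D(2)[OF G] by (simp add: W_adj_def)
  qed
  have "summable (\<lambda>n. if even n then (cmod (taylor_coeff (\<lambda>z. G z $ 1) (n div 2)))\<^sup>2
                       else (cmod (taylor_coeff (\<lambda>z. G z $ 2) (n div 2)))\<^sup>2)"
    by (rule sums_summable[OF sums_interleave]) (rule summable_sums[OF H2_D(3)[OF G]])+
  then show "summable (\<lambda>n. (cmod (if even n then taylor_coeff (\<lambda>z. G z $ 1) (n div 2)
                                  else taylor_coeff (\<lambda>z. G z $ 2) (n div 2)))\<^sup>2)"
    by (rule back_subst[where P = summable]) auto
qed

text \<open>\<open>W\<close> and \<open>W_adj\<close> are mutually inverse and adjoint to each other, i.e. \<open>W\<close> is unitary.\<close>

lemma W_adj_W:
  assumes "f \<in> H2"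
  shows "W_adj (W f) = f"
  by (rule H2_eqI)
    (use assms in \<open>auto simp: W_adj_in_H2 W_in_H2_sq taylor_coeff_W_adj taylor_coeff_W\<close>)

lemma W_W_adj:
  assumes "G \<in> H2_sq"
  shows "W (W_adj G) = G"
proof -
  have "(\<lambda>z. W (W_adj G) z $ i) = (\<lambda>z. G z $ i)" for i
  proof (rule H2_eqI)
    show "(\<lambda>z. W (W_adj G) z $ i) \<in> H2" "(\<lambda>z. G z $ i) \<in> H2"
      using W_in_H2_sq[OF W_adj_in_H2[OF assms]] assms by (auto simp: H2_sq_def)
    show "taylor_coeff (\<lambda>z. W (W_adj G) z $ i) n = taylor_coeff (\<lambda>z. G z $ i) n" for n
      using exhaust_2[of i] taylor_coeff_W[OF W_adj_in_H2[OF assms]] taylor_coeff_W_adj[OF assms]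
      by auto
  qed
  then show ?thesis
    by (simp add: fun_eq_iff vec_eq_iff)
qed

lemma W_adjoint:
  assumes "f \<in> H2" "G \<in> H2_sq"
  shows "H2_sq_inner (W f) G = H2_inner f (W_adj G)"
proof -
  have G: "(\<lambda>z. G z $ i) \<in> H2" and Wf: "(\<lambda>z. W f z $ i) \<in> H2" for i
    using assms(2) W_in_H2_sq[OF assms(1)] by (simp_all add: H2_sq_def)
  have "(\<lambda>n. if even n
               then taylor_coeff (\<lambda>z. W f z $ 1) (n div 2)
                      * cnj (taylor_coeff (\<lambda>z. G z $ 1) (n div 2))
               else taylor_coeff (\<lambda>z. W f z $ 2) (n div 2)
                      * cnj (taylor_coeff (\<lambda>z. G z $ 2) (n div 2)))
          sums (H2_inner (\<lambda>z. W f z $ 1) (\<lambda>z. G z $ 1) + H2_inner (\<lambda>z. W f z $ 2) (\<lambda>z. G z $ 2))"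
    unfolding H2_inner_def by (intro sums_interleave summable_sums H2_inner_summable Wf G)
  moreover have "(if even n
               then taylor_coeff (\<lambda>z. W f z $ 1) (n div 2)
                      * cnj (taylor_coeff (\<lambda>z. G z $ 1) (n div 2))
               else taylor_coeff (\<lambda>z. W f z $ 2) (n div 2)
                      * cnj (taylor_coeff (\<lambda>z. G z $ 2) (n div 2)))
             = taylor_coeff f n * cnj (taylor_coeff (W_adj G) n)" for n
    by (auto simp: taylor_coeff_W[OF assms(1)] taylor_coeff_W_adj[OF assms(2)])
  ultimately show ?thesis
    by (simp add: H2_inner_def[of f] H2_sq_inner_def sum_2 sums_iff)
qed

end

theory Submission
  imports Defs
begin

text \<open>
  If \<open>Q\<^sup>2 = S\<^sup>2\<close> then \<open>Q\<close> commutes with \<open>S\<^sup>2\<close>, which \<open>W\<close> turns into multiplication by \<open>z\<close>; hence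
  \<open>W Q W\<^sup>*\<close> is multiplication by a bounded analytic \<open>2 \<times> 2\<close> matrix \<open>\<Phi>\<close>, and \<open>\<Phi>\<^sup>2 = z\<close>. The off-diagonal
  entries of \<open>\<Phi>\<^sup>2\<close> are those of \<open>\<Phi>\<close> times the trace, so a nonzero trace would make \<open>\<Phi>\<close> diagonal
  and yield an analytic square root of \<open>z\<close>. So the trace vanishes and the determinant is
  \<open>-z\<close>. Finally \<open>\<Phi>(0)\<close> is nilpotent; a unitary \<open>U\<close> whose adjoint has a kernel vector of \<open>\<Phi>(0)\<close> as
  first column makes the first column of \<open>U \<Phi> U\<^sup>*\<close> divisible by \<open>z\<close>.
\<close>

text \<open>The competing meaning of \<open>$\<close> would make parsing exponential in the number of matrix entries.\<close>
no_notation fps_nth (infixl "$" 75)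

section \<open>Zeros and square roots of analytic functions on the disc\<close>

text \<open>By continuity \<open>f\<close> has no zero near \<open>w\<close>, so \<open>g\<close>
  vanishes there, and the identity theorem spreads this over the connected set
  \<open>S\<close>.\<close>

lemma holomorphic_mult_eq_0:
  assumes "f holomorphic_on S" "g holomorphic_on S" "open S" "connected S"
    and prod: "\<And>z. z \<in> S \<Longrightarrow> f z * g z = 0"
    and "w \<in> S" "f w \<noteq> 0" "z \<in> S"
  shows "g z = 0"
proof -
  obtain e where e: "e > 0" "\<forall>y\<in>S. dist y w < e \<longrightarrow> f y \<noteq> 0"
    using continuous_on_avoid[of S f w 0] holomorphic_on_imp_continuous_on[OF assms(1)] assms
    by (metis dist_commute)
  let ?U = "S \<inter> ball w e"
  have "g y = 0" if "y \<in> ?U" for y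
    using e prod[of y] that by (auto simp: dist_commute)
  moreover have "w islimpt ?U"
    using \<open>w \<in> S\<close> \<open>open S\<close> e(1) by (intro interior_limit_point) (simp add: interior_open open_Int)
  ultimately show ?thesis
    using analytic_continuation[OF assms(2,3,4), of ?U w z] \<open>w \<in> S\<close> \<open>z \<in> S\<close> by auto
qed

text \<open>Serves to cancel a factor \<open>z\<close> from an identity on the whole disc, the point
  \<open>0\<close> included.\<close>

lemma cancel_id_disc:
  assumes "g holomorphic_on unit_disc" "\<And>z. z \<in> unit_disc \<Longrightarrow> z * g z = 0" "z \<in> unit_disc"
  shows "g z = 0"
  by (rule holomorphic_mult_eq_0[of "\<lambda>z. z" unit_disc g "1/2"])
    (use assms in \<open>auto intro!: holomorphic_intros\<close>)

text \<open>Such a \<open>p\<close> vanishes at \<open>0\<close>, so its square has derivative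
  \<open>0\<close> there, whereas \<open>z\<close> has derivative \<open>1\<close>.\<close>

lemma no_holomorphic_sqrt_disc:
  assumes "p holomorphic_on unit_disc" "\<And>z. z \<in> unit_disc \<Longrightarrow> (p z)\<^sup>2 = z"
  shows False
proof -
  have p: "(p has_field_derivative deriv p 0) (at 0)"
    using holomorphic_derivI[OF assms(1)] by simp
  have "((\<lambda>z. (p z)\<^sup>2) has_field_derivative 2 * p 0 * deriv p 0) (at 0)"
    by (rule derivative_eq_intros p refl)+ simp
  moreover have "((\<lambda>z. (p z)\<^sup>2) has_field_derivative 1) (at 0)"
    by (rule has_field_derivative_transform_within[of "\<lambda>z. z" _ _ _ 1])
      (use assms(2) in auto)
  moreover have "p 0 = 0"
    using assms(2)[of 0] by simp
  ultimately show False
    using DERIV_unique by fastforce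
qed

section \<open>Estimates and closure properties of \<open>H2\<close>\<close>

lemma H2_norm_nonneg: "f \<in> H2 \<Longrightarrow> 0 \<le> H2_norm f"
  by (simp add: H2_norm_def suminf_nonneg H2_D(3))

lemma cmod_taylor_coeff_le:
  assumes "f \<in> H2"
  shows "cmod (taylor_coeff f n) \<le> H2_norm f"
proof -
  have "sum (\<lambda>n. (cmod (taylor_coeff f n))\<^sup>2) {n} \<le> (\<Sum>n. (cmod (taylor_coeff f n))\<^sup>2)"
    by (rule sum_le_suminf) (use H2_D(3)[OF assms] in auto)
  then show ?thesis
    by (simp add: H2_norm_def real_le_rsqrt)
qed

text \<open>Every Taylor coefficient is at most the norm, so a geometric series dominates the power
  series. The constant is cruder than the one from Cauchy-Schwarz, but it suffices for limits at a
  fixed point.\<close>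

lemma H2_eval_bound:
  assumes "f \<in> H2" "z \<in> unit_disc"
  shows "cmod (f z) \<le> H2_norm f / (1 - cmod z)"
proof -
  have z: "cmod z < 1" using assms(2) by simp
  have "(\<lambda>n. H2_norm f * cmod z ^ n) sums (H2_norm f * (1 / (1 - cmod z)))"
    by (intro sums_mult geometric_sums) (use z in simp)
  moreover have "(\<lambda>n. taylor_coeff f n * z ^ n) sums f z"
    by (rule taylor_coeff_sums[OF H2_D(1)[OF assms(1)] assms(2)])
  moreover have "norm (taylor_coeff f n * z ^ n) \<le> H2_norm f * cmod z ^ n" for n
    by (simp add: norm_mult norm_power mult_right_mono cmod_taylor_coeff_le assms)
  ultimately show ?thesis
    using norm_suminf_le[of "\<lambda>n. taylor_coeff f n * z ^ n" "\<lambda>n. H2_norm f * cmod z ^ n"]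
    by (simp add: sums_iff)
qed

lemma H2_scale:
  assumes "f \<in> H2"
  shows "(\<lambda>z. c * f z) \<in> H2"
proof (rule H2_I[of "\<lambda>n. c * taylor_coeff f n"])
  show "(\<lambda>n. c * taylor_coeff f n * z ^ n) sums (c * f z)" if "z \<in> unit_disc" for z
    using sums_mult[OF taylor_coeff_sums[OF H2_D(1)[OF assms] that], of c] by (simp add: mult_ac)
  show "summable (\<lambda>n. (cmod (c * taylor_coeff f n))\<^sup>2)"
    using summable_mult[OF H2_D(3)[OF assms], of "(cmod c)\<^sup>2"]
    by (simp add: norm_mult power_mult_distrib)
qed (use H2_D(2)[OF assms] in auto)

lemma H2_add:
  assumes "f \<in> H2" "g \<in> H2"
  shows "(\<lambda>z. f z + g z) \<in> H2"
proof (rule H2_I[of "\<lambda>n. taylor_coeff f n + taylor_coeff g n"])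
  show "(\<lambda>n. (taylor_coeff f n + taylor_coeff g n) * z ^ n) sums (f z + g z)"
    if "z \<in> unit_disc" for z
    using sums_add[OF taylor_coeff_sums[OF H2_D(1)[OF assms(1)] that]
        taylor_coeff_sums[OF H2_D(1)[OF assms(2)] that]] by (simp add: distrib_right)
  show "summable (\<lambda>n. (cmod (taylor_coeff f n + taylor_coeff g n))\<^sup>2)"
  proof (rule summable_comparison_test')
    show "summable (\<lambda>n. 2 * (cmod (taylor_coeff f n))\<^sup>2 + 2 * (cmod (taylor_coeff g n))\<^sup>2)"
      by (intro summable_add summable_mult H2_D(3) assms)
    fix n
    have "(cmod (taylor_coeff f n + taylor_coeff g n))\<^sup>2
            \<le> (cmod (taylor_coeff f n) + cmod (taylor_coeff g n))\<^sup>2"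
      by (intro power_mono norm_triangle_ineq) simp
    also have "\<dots> \<le> 2 * (cmod (taylor_coeff f n))\<^sup>2 + 2 * (cmod (taylor_coeff g n))\<^sup>2"
      using sum_squares_bound[of "cmod (taylor_coeff f n)" "cmod (taylor_coeff g n)"]
      by (simp add: power2_sum)
    finally show "norm ((cmod (taylor_coeff f n + taylor_coeff g n))\<^sup>2)
        \<le> 2 * (cmod (taylor_coeff f n))\<^sup>2 + 2 * (cmod (taylor_coeff g n))\<^sup>2" by simp
  qed
qed (use assms[THEN H2_D(2)] in auto)

lemma shift_in_H2:
  assumes "f \<in> H2"
  shows "shift f \<in> H2"
proof (rule H2_I[of "\<lambda>n. case n of 0 \<Rightarrow> 0 | Suc k \<Rightarrow> taylor_coeff f k"])
  show "(\<lambda>n. (case n of 0 \<Rightarrow> 0 | Suc k \<Rightarrow> taylor_coeff f k) * z ^ n) sums shift f z"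
    if "z \<in> unit_disc" for z
    using sums_Suc[of "\<lambda>n. (case n of 0 \<Rightarrow> 0 | Suc k \<Rightarrow> taylor_coeff f k) * z ^ n"]
      sums_mult[OF taylor_coeff_sums[OF H2_D(1)[OF assms] that], of z]
    by (simp add: shift_def mult_ac)
  show "summable (\<lambda>n. (cmod (case n of 0 \<Rightarrow> 0 | Suc k \<Rightarrow> taylor_coeff f k))\<^sup>2)"
    by (subst summable_Suc_iff[symmetric]) (simp add: H2_D(3)[OF assms])
qed (use H2_D(2)[OF assms] in \<open>simp add: shift_def\<close>)

lemma shift_power_in_H2: "f \<in> H2 \<Longrightarrow> (shift ^^ n) f \<in> H2"
  by (induction n) (auto intro: shift_in_H2)

section \<open>Monomials and the squared backward shift\<close>

definition disc_monomial :: "nat \<Rightarrow> complex \<Rightarrow> complex" where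
  "disc_monomial m = (\<lambda>z. if z \<in> unit_disc then z ^ m else 0)"

lemma disc_monomial_sums:
  assumes "z \<in> unit_disc"
  shows "(\<lambda>n. (if n = m then 1 else 0) * z ^ n) sums disc_monomial m z"
  using sums_single[of m "\<lambda>n. z ^ n"] assms
  by (simp add: disc_monomial_def if_distrib[of "\<lambda>c. c * _"] cong: if_cong)

lemma disc_monomial_in_H2: "disc_monomial m \<in> H2"
proof (rule H2_I[OF disc_monomial_sums])
  show "summable (\<lambda>n. (cmod (if n = m then 1 else 0))\<^sup>2)"
    by (rule summable_finite[of "{m}"]) auto
qed (auto simp: disc_monomial_def)

text \<open>On \<open>H2\<close> this is the adjoint of \<open>shift ^^ 2\<close>.\<close>

definition double_backshift :: "(complex \<Rightarrow> complex) \<Rightarrow> complex \<Rightarrow> complex" where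
  "double_backshift f =
     (\<lambda>z. if z \<in> unit_disc then \<Sum>n. taylor_coeff f (n + 2) * z ^ n else 0)"

lemma summable_double_backshift:
  assumes "f \<in> H2"
  shows "summable (\<lambda>n. (cmod (taylor_coeff f (n + 2)))\<^sup>2)"
  using summable_ignore_initial_segment[OF H2_D(3)[OF assms], of 2] .

lemma double_backshift_sums:
  assumes "f \<in> H2" "z \<in> unit_disc"
  shows "(\<lambda>n. taylor_coeff f (n + 2) * z ^ n) sums double_backshift f z"
  using summable_square_imp_summable_powser[OF summable_double_backshift[OF assms(1)] assms(2)]
    assms(2) by (simp add: double_backshift_def summable_sums)

lemma double_backshift_in_H2:
  assumes "f \<in> H2"
  shows "double_backshift f \<in> H2"
  by (rule H2_I[OF double_backshift_sums[OF assms]])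
    (use summable_double_backshift[OF assms] in \<open>auto simp: double_backshift_def\<close>)

lemma taylor_coeff_double_backshift:
  "f \<in> H2 \<Longrightarrow> taylor_coeff (double_backshift f) n = taylor_coeff f (n + 2)"
  by (rule taylor_coeff_eqI) (rule double_backshift_sums)

lemma H2_norm_double_backshift:
  assumes "f \<in> H2"
  shows "H2_norm (double_backshift f) \<le> H2_norm f"
proof -
  have "(\<Sum>n. (cmod (taylor_coeff f (n + 2)))\<^sup>2) \<le> (\<Sum>n. (cmod (taylor_coeff f n))\<^sup>2)"
    using suminf_split_initial_segment[OF H2_D(3)[OF assms], of 2]
      sum_nonneg[of "{..<2}" "\<lambda>n. (cmod (taylor_coeff f n))\<^sup>2"] by simp
  then show ?thesis
    by (simp add: H2_norm_def taylor_coeff_double_backshift[OF assms])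
qed

text \<open>One step of the Wold decomposition for the squared shift: \<open>1\<close> and
  \<open>z\<close> span the orthogonal complement of its range.\<close>

lemma H2_split:
  assumes "f \<in> H2"
  shows "f = (\<lambda>z. (taylor_coeff f 0 * disc_monomial 0 z + taylor_coeff f 1 * disc_monomial 1 z)
                  + (shift ^^ 2) (double_backshift f) z)"
proof
  fix z
  show "f z = (taylor_coeff f 0 * disc_monomial 0 z + taylor_coeff f 1 * disc_monomial 1 z)
                  + (shift ^^ 2) (double_backshift f) z"
  proof (cases "z \<in> unit_disc")
    case True
    have "(\<lambda>n. z\<^sup>2 * (taylor_coeff f (n + 2) * z ^ n)) sums (z\<^sup>2 * double_backshift f z)"
      by (intro sums_mult double_backshift_sums assms True)
    then have "(\<lambda>n. taylor_coeff f (n + 2) * z ^ (n + 2)) sums (z\<^sup>2 * double_backshift f z)"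
      by (simp add: power_add power2_eq_square mult_ac)
    then have "(\<lambda>n. taylor_coeff f n * z ^ n) sums
        (z\<^sup>2 * double_backshift f z + (\<Sum>i<2. taylor_coeff f i * z ^ i))"
      by (subst (asm) sums_iff_shift)
    with taylor_coeff_sums[OF H2_D(1)[OF assms] True]
    have "f z = z\<^sup>2 * double_backshift f z + (\<Sum>i<2. taylor_coeff f i * z ^ i)"
      by (rule sums_unique2)
    with True show ?thesis
      by (simp add: disc_monomial_def shift_def numeral_2_eq_2)
  next
    case False
    then show ?thesis
      using H2_D(2)[OF assms] by (simp add: disc_monomial_def shift_def numeral_2_eq_2 double_backshift_def)
  qed
qed

lemma bounded_operator_H2_nonneg_bound:
  assumes "bounded_operator_H2 T"
  obtains K where "K \<ge> 0" "\<And>f. f \<in> H2 \<Longrightarrow> H2_norm (T f) \<le> K * H2_norm f"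
proof -
  from assms obtain K where K: "H2_norm (T f) \<le> K * H2_norm f" if "f \<in> H2" for f
    unfolding bounded_operator_H2_def by blast
  have "H2_norm (T f) \<le> \<bar>K\<bar> * H2_norm f" if "f \<in> H2" for f
    using K[OF that] mult_right_mono[OF abs_ge_self H2_norm_nonneg[OF that], of K] by linarith
  then show ?thesis
    using that[of "\<bar>K\<bar>"] by simp
qed

section \<open>Even and odd parts: properties of \<open>W\<close>\<close>

lemma W_holomorphic: "f \<in> H2 \<Longrightarrow> (\<lambda>z. W f z $ i) holomorphic_on unit_disc"
  using W_in_H2_sq by (auto simp: H2_sq_def H2_def)

lemma W_outside_disc: "z \<notin> unit_disc \<Longrightarrow> W f z = 0"
  by (simp add: W_def)

lemma square_in_unit_disc_iff: "z\<^sup>2 \<in> unit_disc \<longleftrightarrow> z \<in> unit_disc" for z :: complex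
  by (auto simp: norm_power power_less_one_iff)

text \<open>The points \<open>z\<close> and \<open>-z\<close> have the same square, so comparing the
  equation at both separates even from odd part. This identifies \<open>W f\<close> even when square
  summability of the components of \<open>G\<close> has not been established.\<close>

lemma W_unique:
  fixes G :: "complex \<Rightarrow> complex^2"
  assumes f: "f \<in> H2"
    and hol: "\<And>i. (\<lambda>z. G z $ i) holomorphic_on unit_disc"
    and eq: "\<And>z. z \<in> unit_disc \<Longrightarrow> f z = W_adj G z"
    and w: "w \<in> unit_disc"
  shows "W f w = G w"
proof -
  define D where "D = (\<lambda>i z. W f z $ i - G z $ i)"
  have even_odd: "D 1 (z\<^sup>2) + z * D 2 (z\<^sup>2) = 0" if "z \<in> unit_disc" for z
    using eq[OF that] fun_cong[OF W_adj_W[OF f], of z]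
    by (simp add: D_def W_adj_def algebra_simps)
  \<comment> \<open>At \<open>0\<close> the equations for the two square roots coincide and say
    nothing about \<open>D 2 0\<close>; the extra factor \<open>z\<close> postpones that point to
    \<open>cancel_id_disc\<close>.\<close>
  have zero: "z * D i z = 0" if "z \<in> unit_disc" for i z
  proof (cases "z = 0")
    case False
    define y where "y = csqrt z"
    have y: "y\<^sup>2 = z" "y \<noteq> 0" "y \<in> unit_disc"
      using False that square_in_unit_disc_iff[of y] by (auto simp: y_def)
    have e: "D 1 z + y * D 2 z = 0" "D 1 z - y * D 2 z = 0"
      using even_odd[of y] even_odd[of "- y"] y by simp_all
    then have "y * D 2 z = 0" by (simp add: algebra_simps)
    with e y have "D 1 z = 0" "D 2 z = 0" by auto
    then show ?thesis using exhaust_2[of i] by auto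
  qed simp
  have "D i w = 0" for i
    by (rule cancel_id_disc[OF _ zero w])
      (auto simp: D_def intro!: holomorphic_intros W_holomorphic[OF f] hol)
  then show ?thesis
    by (simp add: vec_eq_iff D_def)
qed

lemma W_disc_monomial:
  assumes "z \<in> unit_disc"
  shows "W (disc_monomial 0) z = axis 1 1" "W (disc_monomial 1) z = axis 2 1"
proof -
  show "W (disc_monomial 0) z = axis 1 1"
    by (rule W_unique[OF disc_monomial_in_H2 _ _ assms])
      (auto simp: W_adj_def axis_def disc_monomial_def)
  show "W (disc_monomial 1) z = axis 2 1"
    by (rule W_unique[OF disc_monomial_in_H2 _ _ assms])
      (auto simp: W_adj_def axis_def disc_monomial_def)
qed

text \<open>\<open>W_adj\<close> evaluates its argument at \<open>z\<^sup>2\<close>, so a factor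
  \<open>z\<close> inside it comes out as the factor \<open>z\<^sup>2\<close> of the squared
  shift.\<close>

lemma W_shift_shift:
  assumes "f \<in> H2" "z \<in> unit_disc"
  shows "W ((shift ^^ 2) f) z = z *s W f z"
proof (rule W_unique[OF shift_power_in_H2[OF assms(1)] _ _ assms(2)])
  fix y :: complex
  show "(shift ^^ 2) f y = W_adj (\<lambda>z. z *s W f z) y"
    by (subst (1) W_adj_W[OF assms(1), symmetric])
      (simp add: W_adj_def shift_def numeral_2_eq_2 algebra_simps)
qed (auto intro!: holomorphic_intros W_holomorphic assms)

text \<open>The coefficients of a component of \<open>W f\<close> form a subsequence of those of
  \<open>f\<close>; the offset \<open>j\<close> selects the even or the odd indices.\<close>

lemma H2_norm_W_le:
  assumes "f \<in> H2"
  shows "H2_norm (\<lambda>z. W f z $ i) \<le> H2_norm f"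
proof -
  define j :: nat where "j = (if i = 1 then 0 else 1)"
  have "(\<Sum>k. (cmod (taylor_coeff f (2 * k + j)))\<^sup>2) \<le> (\<Sum>n. (cmod (taylor_coeff f n))\<^sup>2)"
    using suminf_reindex_mono[of "\<lambda>n. (cmod (taylor_coeff f n))\<^sup>2" "\<lambda>k. 2 * k + j"]
      H2_D(3)[OF assms] by (simp add: o_def inj_on_def)
  moreover have "taylor_coeff (\<lambda>z. W f z $ i) k = taylor_coeff f (2 * k + j)" for k
    using exhaust_2[of i] taylor_coeff_W[OF assms, of k] by (auto simp: j_def)
  ultimately show ?thesis
    by (simp add: H2_norm_def)
qed

lemma axis_component: "(\<lambda>z. axis j (f z) $ i) = (if i = j then f else (\<lambda>z. 0))"
  by (auto simp: axis_def)

lemma axis_in_H2_sq: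
  assumes "f \<in> H2"
  shows "(\<lambda>z. axis j (f z)) \<in> H2_sq"
proof -
  have "(\<lambda>z. 0) \<in> H2"
    by (rule H2_I[of "\<lambda>n. 0"]) auto
  then show ?thesis
    using assms by (simp add: H2_sq_def axis_component)
qed

text \<open>The coefficients of the left-hand function are those of \<open>f\<close> interleaved
  with zeros.\<close>

lemma H2_norm_W_adj_axis:
  assumes "f \<in> H2"
  shows "H2_norm (W_adj (\<lambda>z. axis j (f z))) = H2_norm f"
proof -
  let ?h = "\<lambda>n. (cmod (taylor_coeff f n))\<^sup>2"
  let ?t = "\<lambda>n. (cmod (taylor_coeff (W_adj (\<lambda>z. axis j (f z))) n))\<^sup>2"
  have z: "taylor_coeff (\<lambda>z. 0) n = 0" for n
    by (rule taylor_coeff_eqI) auto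
  have s: "?h sums suminf ?h"
    by (rule summable_sums[OF H2_D(3)[OF assms]])
  have "?t sums suminf ?h"
  proof (cases "j = 1")
    case True
    show ?thesis
      using sums_interleave[OF s sums_zero] True
      by (rule_tac back_subst[where P = "\<lambda>h. h sums _"])
        (auto simp: fun_eq_iff taylor_coeff_W_adj[OF axis_in_H2_sq[OF assms]] axis_component z)
  next
    case False
    then have "j = 2" using exhaust_2[of j] by auto
    with sums_interleave[OF sums_zero s] show ?thesis
      by (rule_tac back_subst[where P = "\<lambda>h. h sums _"])
        (auto simp: fun_eq_iff taylor_coeff_W_adj[OF axis_in_H2_sq[OF assms]] axis_component z)
  qed
  then show ?thesis
    by (simp add: H2_norm_def sums_iff)
qed

section \<open>Operators commuting with the squared shift as matrix multiplications\<close>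

text \<open>\<open>W\<close> sends \<open>1\<close> and \<open>z\<close> to the constant basis
  vectors, so column \<open>j\<close> is the image of the \<open>j\<close>-th basis vector under
  \<open>T\<close> transported by \<open>W\<close>.\<close>

definition symbol :: "((complex \<Rightarrow> complex) \<Rightarrow> complex \<Rightarrow> complex) \<Rightarrow> complex \<Rightarrow> complex^2^2" where
  "symbol T z = (\<chi> i j. W (T (disc_monomial (if j = 1 then 0 else 1))) z $ i)"

context
  fixes T :: "(complex \<Rightarrow> complex) \<Rightarrow> complex \<Rightarrow> complex"
  assumes T: "bounded_operator_H2 T"
    and comm: "\<And>f. f \<in> H2 \<Longrightarrow> T ((shift ^^ 2) f) = (shift ^^ 2) (T f)"
begin

lemma operator_in_H2: "f \<in> H2 \<Longrightarrow> T f \<in> H2"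
  using T by (simp add: bounded_operator_H2_def)

lemma operator_expansion_step:
  assumes f: "f \<in> H2"
  shows "T f z = taylor_coeff f 0 * T (disc_monomial 0) z + taylor_coeff f 1 * T (disc_monomial 1) z
                 + z\<^sup>2 * T (double_backshift f) z"
proof -
  note b = double_backshift_in_H2[OF f]
  have add: "T (\<lambda>z. g z + h z) = (\<lambda>z. T g z + T h z)" if "g \<in> H2" "h \<in> H2" for g h
    using T that by (simp add: bounded_operator_H2_def)
  have scale: "T (\<lambda>z. c * g z) = (\<lambda>z. c * T g z)" if "g \<in> H2" for c g
    using T that by (simp add: bounded_operator_H2_def)
  show ?thesis
    by (subst H2_split[OF f])
      (simp add: add scale H2_add H2_scale disc_monomial_in_H2 comm b shift_power_in_H2,
        simp add: shift_def numeral_2_eq_2)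
qed

text \<open>Iterates \<open>operator_expansion_step\<close> on the tail. Membership and the
  coefficient formula for the iterated backshift keep the induction going; the norm bound is there
  to control the remainder.\<close>

lemma operator_expansion:
  assumes f: "f \<in> H2"
  shows "T f z = (\<Sum>k<N. (taylor_coeff f (2 * k) * T (disc_monomial 0) z
                        + taylor_coeff f (2 * k + 1) * T (disc_monomial 1) z) * (z\<^sup>2) ^ k)
                 + (z\<^sup>2) ^ N * T ((double_backshift ^^ N) f) z
         \<and> (double_backshift ^^ N) f \<in> H2 \<and> H2_norm ((double_backshift ^^ N) f) \<le> H2_norm f
         \<and> (\<forall>n. taylor_coeff ((double_backshift ^^ N) f) n = taylor_coeff f (n + 2 * N))"
proof (induction N)
  case 0
  show ?case using f by simp
next
  case (Suc N)
  let ?g = "(double_backshift ^^ N) f"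
  have g: "?g \<in> H2" using Suc by simp
  have "H2_norm (double_backshift ?g) \<le> H2_norm f"
    using H2_norm_double_backshift[OF g] Suc by linarith
  moreover have "T f z = (\<Sum>k<Suc N. (taylor_coeff f (2 * k) * T (disc_monomial 0) z
                        + taylor_coeff f (2 * k + 1) * T (disc_monomial 1) z) * (z\<^sup>2) ^ k)
                 + (z\<^sup>2) ^ Suc N * T (double_backshift ?g) z"
    using Suc operator_expansion_step[OF g, of z] by (simp add: algebra_simps)
  ultimately show ?case
    using Suc double_backshift_in_H2[OF g] by (simp add: taylor_coeff_double_backshift[OF g])
qed

text \<open>
  The remainder of the expansion tends to \<open>0\<close> because double backshifts do not increase the norm
  and point evaluations are bounded.
\<close>

lemma operator_eq_W:
  assumes f: "f \<in> H2" and z: "z \<in> unit_disc"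
  shows "T f z = W f (z\<^sup>2) $ 1 * T (disc_monomial 0) z + W f (z\<^sup>2) $ 2 * T (disc_monomial 1) z"
proof -
  obtain K where K: "K \<ge> 0" "\<And>f. f \<in> H2 \<Longrightarrow> H2_norm (T f) \<le> K * H2_norm f"
    using bounded_operator_H2_nonneg_bound[OF T] by metis
  have z2: "z\<^sup>2 \<in> unit_disc" using z square_in_unit_disc_iff by blast
  let ?s = "\<lambda>k. (taylor_coeff f (2 * k) * T (disc_monomial 0) z
                        + taylor_coeff f (2 * k + 1) * T (disc_monomial 1) z) * (z\<^sup>2) ^ k"
  have "?s sums (W f (z\<^sup>2) $ 1 * T (disc_monomial 0) z + W f (z\<^sup>2) $ 2 * T (disc_monomial 1) z)"
    using sums_add[OF sums_mult2[OF W_sums(1)[OF f z2], of "T (disc_monomial 0) z"]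
        sums_mult2[OF W_sums(2)[OF f z2], of "T (disc_monomial 1) z"]]
    by (simp add: algebra_simps)
  moreover have "(\<lambda>N. (z\<^sup>2) ^ N * T ((double_backshift ^^ N) f) z) \<longlonglongrightarrow> 0"
  proof (rule Lim_null_comparison)
    let ?C = "K * H2_norm f / (1 - cmod z)"
    have "cmod (z\<^sup>2) < 1" using z2 by simp
    then show "(\<lambda>N. cmod (z\<^sup>2) ^ N * ?C) \<longlonglongrightarrow> 0"
      by (intro tendsto_mult_left_zero LIMSEQ_power_zero) simp
    show "\<forall>\<^sub>F N in sequentially. norm ((z\<^sup>2) ^ N * T ((double_backshift ^^ N) f) z)
            \<le> cmod (z\<^sup>2) ^ N * ?C"
    proof (rule always_eventually, rule allI)
      fix N
      let ?g = "(double_backshift ^^ N) f"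
      have g: "?g \<in> H2" "H2_norm ?g \<le> H2_norm f" using operator_expansion[OF f] by auto
      have "cmod (T ?g z) \<le> H2_norm (T ?g) / (1 - cmod z)"
        by (rule H2_eval_bound[OF operator_in_H2[OF g(1)] z])
      also have "\<dots> \<le> ?C"
        using K(2)[OF g(1)] mult_left_mono[OF g(2) K(1)] z by (intro divide_right_mono) auto
      finally show "norm ((z\<^sup>2) ^ N * T ?g z) \<le> cmod (z\<^sup>2) ^ N * ?C"
        by (simp only: norm_mult norm_power mult_left_mono zero_le_power norm_ge_zero)
    qed
  qed
  ultimately have "(\<lambda>N. (\<Sum>k<N. ?s k) + (z\<^sup>2) ^ N * T ((double_backshift ^^ N) f) z) \<longlonglongrightarrow>
      (W f (z\<^sup>2) $ 1 * T (disc_monomial 0) z + W f (z\<^sup>2) $ 2 * T (disc_monomial 1) z) + 0"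
    unfolding sums_def by (rule tendsto_add)
  moreover have "(\<lambda>N. (\<Sum>k<N. ?s k) + (z\<^sup>2) ^ N * T ((double_backshift ^^ N) f) z) = (\<lambda>N. T f z)"
    using operator_expansion[OF f, of z] by auto
  ultimately show ?thesis
    using LIMSEQ_unique[OF tendsto_const] by fastforce
qed

lemma symbol_holomorphic: "(\<lambda>z. symbol T z $ i $ j) holomorphic_on unit_disc"
  by (simp add: symbol_def W_holomorphic[OF operator_in_H2[OF disc_monomial_in_H2]])

text \<open>By \<open>operator_eq_W\<close>, \<open>T f\<close> combines the images of
  \<open>1\<close> and \<open>z\<close> with coefficients \<open>W f (z\<^sup>2)\<close>. Splitting
  those images into even and odd parts produces the matrix product.\<close>

lemma W_operator:
  assumes f: "f \<in> H2" and w: "w \<in> unit_disc"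
  shows "W (T f) w = symbol T w *v W f w"
proof (rule W_unique[OF operator_in_H2[OF f] _ _ w])
  show "(\<lambda>z. (symbol T z *v W f z) $ i) holomorphic_on unit_disc" for i
    by (simp add: matrix_vector_mult_def sum_2)
      (intro holomorphic_intros symbol_holomorphic W_holomorphic f)
  show "T f z = W_adj (\<lambda>z. symbol T z *v W f z) z" if z: "z \<in> unit_disc" for z
  proof -
    have "T (disc_monomial m) z = W (T (disc_monomial m)) (z\<^sup>2) $ 1
            + z * W (T (disc_monomial m)) (z\<^sup>2) $ 2" for m
      using fun_cong[OF W_adj_W[OF operator_in_H2[OF disc_monomial_in_H2]], of m z] by (simp add: W_adj_def)
    from this[of 0] this[of 1] operator_eq_W[OF f z] show ?thesis
      by (simp add: W_adj_def matrix_vector_mult_def sum_2 symbol_def algebra_simps)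
  qed
qed

text \<open>
  Compressing \<open>T\<close> to one entry \<open>\<phi>\<close> of its symbol gives \<open>\<parallel>\<phi>\<^sup>n\<parallel> \<le> K\<^sup>n \<parallel>1\<parallel>\<close>. Evaluating at \<open>z\<close> and letting
  \<open>n\<close> grow gives \<open>|\<phi> z| \<le> K\<close>.
\<close>

lemma symbol_in_Hinf: "(\<lambda>z. symbol T z $ i $ j) \<in> Hinf"
proof -
  obtain K where K: "K \<ge> 0" "\<And>f. f \<in> H2 \<Longrightarrow> H2_norm (T f) \<le> K * H2_norm f"
    using bounded_operator_H2_nonneg_bound[OF T] by metis
  define \<phi> where "\<phi> = (\<lambda>z. symbol T z $ i $ j)"
  \<comment> \<open>The cut-off matters for \<open>n = 0\<close>, where the plain power would be
    \<open>1\<close> outside the disc.\<close>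
  define pw where "pw = (\<lambda>n z. if z \<in> unit_disc then \<phi> z ^ n else 0)"
  define C where "C = H2_norm (disc_monomial 0)"
  have pw: "pw n \<in> H2 \<and> H2_norm (pw n) \<le> K ^ n * C" for n
  proof (induction n)
    case 0
    have "pw 0 = disc_monomial 0" by (simp add: fun_eq_iff pw_def disc_monomial_def)
    then show ?case by (simp add: disc_monomial_in_H2 C_def)
  next
    case (Suc n)
    \<comment> \<open>Placing the power in coordinate \<open>j\<close> and reading off coordinate
      \<open>i\<close> after applying the symbol multiplies it by exactly the chosen entry.\<close>
    define F where "F = (\<lambda>z. axis j (pw n z) :: complex^2)"
    have F: "F \<in> H2_sq" using Suc by (simp add: F_def axis_in_H2_sq)
    note G = W_adj_in_H2[OF F]
    have "(\<lambda>z. W (T (W_adj F)) z $ i) = pw (Suc n)"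
    proof
      fix z
      show "W (T (W_adj F)) z $ i = pw (Suc n) z"
      proof (cases "z \<in> unit_disc")
        case True
        have "W (T (W_adj F)) z = symbol T z *v F z"
          using W_operator[OF G True] by (simp add: W_W_adj[OF F])
        then show ?thesis
          using True exhaust_2[of j]
          by (auto simp: matrix_vector_mult_def sum_2 pw_def \<phi>_def F_def axis_def)
      next
        case False
        then show ?thesis by (simp add: pw_def W_outside_disc)
      qed
    qed
    moreover have "(\<lambda>z. W (T (W_adj F)) z $ i) \<in> H2"
      using W_in_H2_sq[OF operator_in_H2[OF G]] by (simp add: H2_sq_def)
    moreover have "H2_norm (\<lambda>z. W (T (W_adj F)) z $ i) \<le> K ^ Suc n * C"
    proof -
      have "H2_norm (\<lambda>z. W (T (W_adj F)) z $ i) \<le> H2_norm (T (W_adj F))"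
        by (rule H2_norm_W_le[OF operator_in_H2[OF G]])
      also have "\<dots> \<le> K * H2_norm (W_adj F)" by (rule K(2)[OF G])
      also have "\<dots> = K * H2_norm (pw n)" using Suc by (simp add: F_def H2_norm_W_adj_axis)
      also have "\<dots> \<le> K * (K ^ n * C)" using Suc K(1) by (simp add: mult_left_mono)
      finally show ?thesis by (simp add: mult_ac)
    qed
    ultimately show ?case by simp
  qed
  have "cmod (\<phi> z) \<le> K" if z: "z \<in> unit_disc" for z
  proof (rule ccontr)
    assume "\<not> cmod (\<phi> z) \<le> K"
    then have less: "K < cmod (\<phi> z)" by simp
    define x where "x = K / cmod (\<phi> z)"
    have pos: "cmod (\<phi> z) > 0" using less K(1) by linarith
    then have x: "0 \<le> x" "x < 1" using less K(1) by (simp_all add: x_def)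
    have "1 \<le> x ^ n * (C / (1 - cmod z))" for n
    proof -
      have "cmod (\<phi> z) ^ n \<le> H2_norm (pw n) / (1 - cmod z)"
        using H2_eval_bound[of "pw n" z] pw[of n] z by (simp add: pw_def norm_power)
      also have "\<dots> \<le> K ^ n * C / (1 - cmod z)"
        using pw[of n] z by (intro divide_right_mono) auto
      finally have "cmod (\<phi> z) ^ n \<le> K ^ n * (C / (1 - cmod z))" by simp
      then have "cmod (\<phi> z) ^ n / cmod (\<phi> z) ^ n \<le> K ^ n * (C / (1 - cmod z)) / cmod (\<phi> z) ^ n"
        by (rule divide_right_mono) simp
      then show ?thesis using pos by (simp add: x_def power_divide mult_ac)
    qed
    moreover have "(\<lambda>n. x ^ n * (C / (1 - cmod z))) \<longlonglongrightarrow> 0"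
      using x by (intro tendsto_mult_left_zero LIMSEQ_power_zero) simp
    ultimately have "(1::real) \<le> 0"
      by (intro LIMSEQ_le_const) auto
    then show False by simp
  qed
  then have "bounded (\<phi> ` unit_disc)"
    unfolding bounded_iff by blast
  moreover have "\<phi> z = 0" if "z \<notin> unit_disc" for z
    using that by (simp add: \<phi>_def symbol_def W_outside_disc)
  ultimately show ?thesis
    using symbol_holomorphic by (simp add: Hinf_def \<phi>_def)
qed

end

section \<open>The algebra \<open>Hinf\<close>: constant combinations and division by
  \<open>z\<close>\<close>

lemma Hinf_D:
  assumes "f \<in> Hinf"
  shows "f holomorphic_on unit_disc" "z \<notin> unit_disc \<Longrightarrow> f z = 0" "bounded (f ` unit_disc)"
  using assms by (auto simp: Hinf_def)

lemma Hinf_scale: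
  assumes "f \<in> Hinf"
  shows "(\<lambda>z. c * f z) \<in> Hinf"
proof -
  have "bounded ((\<lambda>w. c * w) ` f ` unit_disc)"
    by (rule bounded_linear_image[OF Hinf_D(3)[OF assms] bounded_linear_mult_right])
  then show ?thesis
    using Hinf_D[OF assms] by (auto simp: Hinf_def image_image intro!: holomorphic_intros)
qed

lemma Hinf_add:
  assumes "f \<in> Hinf" "g \<in> Hinf"
  shows "(\<lambda>z. f z + g z) \<in> Hinf"
  using assms bounded_plus_comp[of f unit_disc g]
  by (auto simp: Hinf_def intro!: holomorphic_intros)

lemma Hinf_conjugate:
  fixes A B :: "complex^2^2" and \<Phi> :: "complex \<Rightarrow> complex^2^2"
  assumes "\<And>i j. (\<lambda>z. \<Phi> z $ i $ j) \<in> Hinf"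
  shows "(\<lambda>z. (A ** \<Phi> z ** B) $ i $ j) \<in> Hinf"
proof -
  have entry: "(A ** \<Phi> z ** B) $ i $ j =
      B $ 1 $ j * (A $ i $ 1 * \<Phi> z $ 1 $ 1 + A $ i $ 2 * \<Phi> z $ 2 $ 1)
       + B $ 2 $ j * (A $ i $ 1 * \<Phi> z $ 1 $ 2 + A $ i $ 2 * \<Phi> z $ 2 $ 2)" for z
    by (simp add: matrix_matrix_mult_def sum_2 algebra_simps)
  show ?thesis
    unfolding entry by (rule Hinf_add Hinf_scale assms)+
qed

text \<open>The singularity of the quotient at \<open>0\<close> is removable. The quotient is
  bounded by compactness where \<open>cmod z \<le> 1/2\<close>, and elsewhere because division by
  \<open>z\<close> costs at most a factor \<open>2\<close>.\<close>

lemma Hinf_divide_id: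
  assumes "f \<in> Hinf" "f 0 = 0"
  obtains g where "g \<in> Hinf" "\<And>z. f z = z * g z"
proof -
  define h where "h = (\<lambda>z. if z = 0 then deriv f 0 else (f z - f 0) / (z - 0))"
  define g where "g = (\<lambda>z. if z \<in> unit_disc then h z else 0)"
  have h: "h holomorphic_on unit_disc"
    unfolding h_def by (rule pole_lemma[OF Hinf_D(1)[OF assms(1)]]) simp
  then have g: "g holomorphic_on unit_disc"
    by (rule holomorphic_transform) (simp add: g_def)
  obtain B where B: "cmod (f z) \<le> B" if "z \<in> unit_disc" for z
    using Hinf_D(3)[OF assms(1)] unfolding bounded_iff by blast
  have "compact (h ` cball 0 (1/2))"
    by (intro compact_continuous_image holomorphic_on_imp_continuous_on holomorphic_on_subset[OF h])
      auto
  then have "bounded (h ` cball 0 (1/2))"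
    by (rule compact_imp_bounded)
  then obtain B' where B': "cmod (h z) \<le> B'" if "z \<in> cball 0 (1/2)" for z
    unfolding bounded_iff by blast
  have "cmod (g z) \<le> max (2 * B) B'" if z: "z \<in> unit_disc" for z
  proof (cases "z \<in> cball 0 (1/2)")
    case True
    then show ?thesis using B'[OF True] z by (simp add: g_def)
  next
    case False
    then have half: "1/2 < cmod z" by simp
    then have "z \<noteq> 0" by auto
    then have "cmod (g z) = cmod (f z) / cmod z"
      using z by (simp add: g_def h_def assms(2) norm_divide)
    also have "\<dots> \<le> B / (1/2)"
      using B[OF z] half by (intro frac_le) (auto intro: order_trans[OF norm_ge_zero])
    finally show ?thesis by simp
  qed
  then have "bounded (g ` unit_disc)"
    unfolding bounded_iff by blast
  then have "g \<in> Hinf"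
    using g by (simp add: Hinf_def g_def)
  moreover have "f z = z * g z" for z
    using Hinf_D(2)[OF assms(1), of z] assms(2) by (auto simp: g_def h_def)
  ultimately show ?thesis by (rule that)
qed

section \<open>Two-by-two matrices with scalar square\<close>

lemma square_eq_mat_2:
  fixes A :: "complex^2^2"
  assumes "A ** A = mat z"
  shows "(A $ 1 $ 1)\<^sup>2 + A $ 1 $ 2 * A $ 2 $ 1 = z"
    "(A $ 2 $ 2)\<^sup>2 + A $ 1 $ 2 * A $ 2 $ 1 = z"
    "A $ 1 $ 2 * (A $ 1 $ 1 + A $ 2 $ 2) = 0"
    "A $ 2 $ 1 * (A $ 1 $ 1 + A $ 2 $ 2) = 0"
proof -
  have "(A ** A) $ i $ j = mat z $ i $ j" for i j using assms by simp
  from this[of 1 1] this[of 2 2] this[of 1 2] this[of 2 1]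
  show "(A $ 1 $ 1)\<^sup>2 + A $ 1 $ 2 * A $ 2 $ 1 = z"
    "(A $ 2 $ 2)\<^sup>2 + A $ 1 $ 2 * A $ 2 $ 1 = z"
    "A $ 1 $ 2 * (A $ 1 $ 1 + A $ 2 $ 2) = 0"
    "A $ 2 $ 1 * (A $ 1 $ 1 + A $ 2 $ 2) = 0"
    by (simp_all add: matrix_matrix_mult_def sum_2 mat_def power2_eq_square algebra_simps)
qed

text \<open>A trace that is nonzero at one point forces the (1,2) entry to vanish on the whole disc,
  which makes the (1,1) entry an analytic square root of \<open>z\<close>.\<close>

lemma trace_sqrt_id_eq_0:
  fixes M :: "complex \<Rightarrow> complex^2^2"
  assumes hol: "\<And>i j. (\<lambda>z. M z $ i $ j) holomorphic_on unit_disc"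
    and sq: "\<And>z. z \<in> unit_disc \<Longrightarrow> M z ** M z = mat z"
    and z: "z \<in> unit_disc"
  shows "M z $ 1 $ 1 + M z $ 2 $ 2 = 0"
proof (rule ccontr)
  assume nz: "M z $ 1 $ 1 + M z $ 2 $ 2 \<noteq> 0"
  have "M w $ 1 $ 2 = 0" if "w \<in> unit_disc" for w
    by (rule holomorphic_mult_eq_0[of "\<lambda>z. M z $ 1 $ 1 + M z $ 2 $ 2" unit_disc "\<lambda>z. M z $ 1 $ 2" z])
      (use nz z that square_eq_mat_2(3)[OF sq] in \<open>auto intro!: holomorphic_intros hol simp: mult.commute\<close>)
  then have "(M w $ 1 $ 1)\<^sup>2 = w" if "w \<in> unit_disc" for w
    using square_eq_mat_2(1)[OF sq[OF that]] that by simp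
  then show False
    using no_holomorphic_sqrt_disc[OF hol] by blast
qed

text \<open>A unit kernel vector of \<open>A\<close>, completed to an orthonormal basis, is the
  first column of \<open>adjoint_matrix U\<close>; multiplication by \<open>A\<close> annihilates
  that column.\<close>

lemma nilpotent_triangularize:
  fixes A :: "complex^2^2"
  assumes "A ** A = mat 0"
  obtains U where "unitary_matrix U" "\<And>i. (U ** A ** adjoint_matrix U) $ i $ 1 = 0"
proof -
  obtain v where v: "v \<noteq> 0" "A *v v = 0"
  proof (cases "A *v axis 1 1 = 0 \<and> A *v axis 2 1 = 0")
    case True
    then show ?thesis using that[of "axis 1 1"] by (simp add: axis_eq_0_iff)
  next
    case False
    \<comment> \<open>Since \<open>A\<close> squares to zero, a nonzero vector in its range is a
      kernel vector.\<close>
    then obtain j where "A *v axis j 1 \<noteq> 0" by blast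
    moreover have "A *v (A *v axis j 1) = 0"
      using assms by (simp add: matrix_vector_mul_assoc)
    ultimately show ?thesis using that by blast
  qed
  define n where "n = complex_of_real (sqrt ((cmod (v $ 1))\<^sup>2 + (cmod (v $ 2))\<^sup>2))"
  have n2: "n\<^sup>2 = v $ 1 * cnj (v $ 1) + v $ 2 * cnj (v $ 2)"
    by (simp only: n_def complex_norm_square[symmetric] of_real_power[symmetric]
        of_real_add[symmetric]) simp
  have n: "n \<noteq> 0" "cnj n = n"
    using v(1) by (auto simp: n_def vec_eq_iff forall_2 add_nonneg_eq_0_iff)
  define x y where "x = v $ 1 / n" and "y = v $ 2 / n"
  have "x * cnj x + y * cnj y = (v $ 1 * cnj (v $ 1) + v $ 2 * cnj (v $ 2)) / n\<^sup>2"
    using n by (simp add: x_def y_def add_divide_distrib power2_eq_square)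
  then have xy: "x * cnj x + y * cnj y = 1"
    using n by (simp flip: n2)
  have ker: "A $ i $ 1 * x + A $ i $ 2 * y = 0" for i
  proof -
    have "(A *v v) $ i = 0" using v by simp
    then have "(A $ i $ 1 * v $ 1 + A $ i $ 2 * v $ 2) / n = 0"
      by (simp add: matrix_vector_mult_def sum_2)
    then show ?thesis by (simp add: x_def y_def add_divide_distrib)
  qed
  \<comment> \<open>The columns of the adjoint are \<open>(x, y)\<close> and the orthogonal unit
    vector \<open>(- cnj y, cnj x)\<close>.\<close>
  define U :: "complex^2^2" where "U = vector [vector [cnj x, cnj y], vector [- y, x]]"
  have "unitary_matrix U"
    using xy by (simp add: unitary_matrix_def U_def adjoint_matrix_def matrix_matrix_mult_def
        sum_2 vec_eq_iff forall_2 mat_def mult.commute add.commute)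
  moreover have "(U ** A ** adjoint_matrix U) $ i $ 1 = 0" for i
  proof -
    have "(U ** A ** adjoint_matrix U) $ i $ 1 =
            U $ i $ 1 * (A $ 1 $ 1 * x + A $ 1 $ 2 * y) + U $ i $ 2 * (A $ 2 $ 1 * x + A $ 2 $ 2 * y)"
      by (simp add: matrix_matrix_mult_def sum_2 adjoint_matrix_def U_def algebra_simps)
    then show ?thesis by (simp add: ker)
  qed
  ultimately show ?thesis by (rule that)
qed

section \<open>Square roots of the squared shift\<close>

text \<open>Transporting the operator identity by \<open>W\<close> gives the matrix identity on
  every vector \<open>W f z\<close>; the choices \<open>1\<close> and \<open>z\<close> for
  \<open>f\<close> make these the basis vectors.\<close>

lemma symbol_square:
  assumes Q: "bounded_operator_H2 Q"
    and sq: "\<And>f. f \<in> H2 \<Longrightarrow> Q (Q f) = (shift ^^ 2) f"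
    and z: "z \<in> unit_disc"
  shows "symbol Q z ** symbol Q z = mat z"
proof -
  have Q_H2: "Q f \<in> H2" if "f \<in> H2" for f
    using Q that by (simp add: bounded_operator_H2_def)
  \<comment> \<open>Both sides equal \<open>Q (Q (Q f))\<close>.\<close>
  have comm: "Q ((shift ^^ 2) f) = (shift ^^ 2) (Q f)" if "f \<in> H2" for f
    using sq[OF that] sq[OF Q_H2[OF that]] by simp
  have "(symbol Q z ** symbol Q z) *v W f z = mat z *v W f z" if f: "f \<in> H2" for f
  proof -
    have "mat z *v W f z = z *s W f z"
      by (simp add: vec_eq_iff forall_2 matrix_vector_mult_def sum_2 mat_def)
    also have "\<dots> = W (Q (Q f)) z"
      using W_shift_shift[OF f z] sq[OF f] by simp
    also have "\<dots> = symbol Q z *v (symbol Q z *v W f z)"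
      by (simp add: W_operator[where T = Q, OF Q comm _ z] Q_H2 f)
    finally show ?thesis by (simp add: matrix_vector_mul_assoc)
  qed
  from this[OF disc_monomial_in_H2, of 0] this[OF disc_monomial_in_H2, of 1]
  have "(symbol Q z ** symbol Q z) *v axis j 1 = mat z *v axis j 1" for j
    using exhaust_2[of j] z by (auto simp: W_disc_monomial simp del: One_nat_def)
  from this[of 1] this[of 2] show ?thesis
    unfolding vec_eq_iff by (simp add: forall_2 matrix_vector_mult_def sum_2 axis_def)
qed

lemma square_root_form:
  assumes Q: "bounded_operator_H2 Q"
    and sq: "\<And>f. f \<in> H2 \<Longrightarrow> Q (Q f) = (shift ^^ 2) f"
  shows "(\<exists>U a b c.
            unitary_matrix U \<and> a \<in> Hinf \<and> b \<in> Hinf \<and> c \<in> Hinf \<and>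
            (\<forall>z\<in>unit_disc. z * (a z)\<^sup>2 + b z * c z = 1) \<and>
            (\<forall>f\<in>H2. Q f =
               W_adj
                 (matrix_op (\<lambda>z. adjoint_matrix U)
                   (matrix_op (\<lambda>z. vector [vector [z * a z, b z], vector [z * c z, - (z * a z)]])
                     (matrix_op (\<lambda>z. U) (W f))))))"
proof -
  have Q_H2: "Q f \<in> H2" if "f \<in> H2" for f
    using Q that by (simp add: bounded_operator_H2_def)
  have comm: "Q ((shift ^^ 2) f) = (shift ^^ 2) (Q f)" if "f \<in> H2" for f
    using sq[OF that] sq[OF Q_H2[OF that]] by simp
  obtain U where U: "unitary_matrix U"
    and col: "\<And>i. (U ** symbol Q 0 ** adjoint_matrix U) $ i $ 1 = 0"
    using nilpotent_triangularize[OF symbol_square[OF Q sq, of 0]] by auto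
  have UU: "adjoint_matrix U ** U = mat 1" using U by (simp add: unitary_matrix_def)
  define M where "M = (\<lambda>z. U ** symbol Q z ** adjoint_matrix U)"
  have M: "(\<lambda>z. M z $ i $ j) \<in> Hinf" for i j
    unfolding M_def by (rule Hinf_conjugate) (rule symbol_in_Hinf[where T = Q, OF Q comm])
  have symbol_M: "adjoint_matrix U ** (M z ** U) = symbol Q z" for z
    by (simp add: M_def matrix_mul_assoc UU) (simp add: matrix_mul_assoc[symmetric] UU)
  have M_sq: "M z ** M z = mat z" if z: "z \<in> unit_disc" for z
  proof -
    have "M z ** M z = U ** symbol Q z ** (adjoint_matrix U ** U) ** symbol Q z ** adjoint_matrix U"
      by (simp add: M_def matrix_mul_assoc)
    also have "\<dots> = U ** (symbol Q z ** symbol Q z) ** adjoint_matrix U"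
      by (simp add: UU matrix_mul_assoc)
    also have "\<dots> = U ** mat z ** adjoint_matrix U"
      by (simp add: symbol_square[OF Q sq z])
    also have "U ** mat z = mat z ** U"
      by (simp add: vec_eq_iff forall_2 matrix_matrix_mult_def sum_2 mat_def)
    also have "mat z ** U ** adjoint_matrix U = mat z"
      using U by (simp add: unitary_matrix_def matrix_mul_assoc[symmetric])
    finally show ?thesis .
  qed
  \<comment> \<open>By the choice of \<open>U\<close>, the first column of \<open>M\<close> vanishes
    at \<open>0\<close>, so both of its entries are divisible by \<open>z\<close> within
    \<open>Hinf\<close>.\<close>
  obtain a where a: "a \<in> Hinf" "\<And>z. M z $ 1 $ 1 = z * a z"
    using Hinf_divide_id[OF M[of 1 1]] col by (auto simp: M_def)
  obtain c where c: "c \<in> Hinf" "\<And>z. M z $ 2 $ 1 = z * c z"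
    using Hinf_divide_id[OF M[of 2 1]] col by (auto simp: M_def)
  define b where "b = (\<lambda>z. M z $ 1 $ 2)"
  have b: "b \<in> Hinf" using M by (simp add: b_def)
  \<comment> \<open>The (1,1) entry of \<open>M z ** M z = mat z\<close> is this identity multiplied
    by \<open>z\<close>.\<close>
  have "z * (a z)\<^sup>2 + b z * c z - 1 = 0" if "z \<in> unit_disc" for z
  proof (rule cancel_id_disc[OF _ _ that])
    show "(\<lambda>z. z * (a z)\<^sup>2 + b z * c z - 1) holomorphic_on unit_disc"
      by (intro holomorphic_intros Hinf_D(1) a b c)
    show "w * (w * (a w)\<^sup>2 + b w * c w - 1) = 0" if "w \<in> unit_disc" for w
      using square_eq_mat_2(1)[OF M_sq[OF that]] a(2)[of w] c(2)[of w]
      by (simp add: b_def algebra_simps power2_eq_square)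
  qed
  then have id: "z * (a z)\<^sup>2 + b z * c z = 1" if "z \<in> unit_disc" for z
    using that by simp
  \<comment> \<open>Vanishing of the trace determines the (2,2) entry.\<close>
  have form: "vector [vector [z * a z, b z], vector [z * c z, - (z * a z)]] = M z"
    if "z \<in> unit_disc" for z
    using trace_sqrt_id_eq_0[OF Hinf_D(1)[OF M] M_sq that] a(2)[of z] c(2)[of z]
    by (simp add: vec_eq_iff forall_2 b_def neg_eq_iff_add_eq_0)
  have "Q f = W_adj (\<lambda>z. adjoint_matrix U *v
       (vector [vector [z * a z, b z], vector [z * c z, - (z * a z)]] *v (U *v W f z)))"
    if f: "f \<in> H2" for f
  proof -
    have "W (Q f) = (\<lambda>z. adjoint_matrix U *v
       (vector [vector [z * a z, b z], vector [z * c z, - (z * a z)]] *v (U *v W f z)))"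
    proof
      fix z
      show "W (Q f) z = adjoint_matrix U *v
       (vector [vector [z * a z, b z], vector [z * c z, - (z * a z)]] *v (U *v W f z))"
      \<comment> \<open>\<open>form\<close> is stated on the disc only; outside, both sides are zero
        because every \<open>W\<close> image vanishes there.\<close>
      proof (cases "z \<in> unit_disc")
        case True
        have "W (Q f) z = symbol Q z *v W f z"
          by (rule W_operator[where T = Q, OF Q comm f True])
        also have "\<dots> = adjoint_matrix U *v (M z *v (U *v W f z))"
          by (simp add: matrix_vector_mul_assoc symbol_M flip: matrix_mul_assoc)
        finally show ?thesis
          by (simp only: form[OF True])
      next
        case False
        then show ?thesis by (simp add: W_outside_disc)
      qed
    qed
    then show ?thesis
      using W_adj_W[OF Q_H2[OF f]] by simp
  qed
  then have Q_form: "\<forall>f\<in>H2. Q f = W_adj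
                 (matrix_op (\<lambda>z. adjoint_matrix U)
                   (matrix_op (\<lambda>z. vector [vector [z * a z, b z], vector [z * c z, - (z * a z)]])
                     (matrix_op (\<lambda>z. U) (W f))))"
    by (simp add: matrix_op_def)
  show ?thesis
    by (intro exI[of _ U] exI[of _ a] exI[of _ b] exI[of _ c] conjI U a(1) b c(1) ballI id
        Q_form[THEN bspec])
qed

text \<open>\<open>W\<close> turns \<open>Q\<close> into multiplication by \<open>M\<close>, hence
  its square into multiplication by \<open>z\<close>, which is the squared shift. Since
  \<open>M\<close> is only assumed holomorphic, \<open>W (Q f)\<close> is computed with
  \<open>W_unique\<close> rather than \<open>W_W_adj\<close>, which would require the product to lie
  in \<open>H2_sq\<close>.\<close>

lemma square_eq_shift_square:
  fixes M :: "complex \<Rightarrow> complex^2^2"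
  assumes Q: "\<And>f. f \<in> H2 \<Longrightarrow> Q f \<in> H2"
    and hol: "\<And>i j. (\<lambda>z. M z $ i $ j) holomorphic_on unit_disc"
    and sq: "\<And>z. z \<in> unit_disc \<Longrightarrow> M z ** M z = mat z"
    and form: "\<And>f. f \<in> H2 \<Longrightarrow> Q f = W_adj (\<lambda>z. M z *v W f z)"
    and f: "f \<in> H2"
  shows "Q (Q f) = (shift ^^ 2) f"
proof -
  have WQ: "W (Q f) z = M z *v W f z" if "z \<in> unit_disc" for z
  proof (rule W_unique[OF Q[OF f] _ _ that])
    show "(\<lambda>z. (M z *v W f z) $ i) holomorphic_on unit_disc" for i
      by (simp add: matrix_vector_mult_def sum_2)
        (intro holomorphic_intros hol W_holomorphic f)
  qed (simp add: form f)
  have "M z *v W (Q f) z = z *s W f z" for z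
  proof (cases "z \<in> unit_disc")
    case True
    then have "M z *v W (Q f) z = mat z *v W f z"
      by (simp add: WQ matrix_vector_mul_assoc sq)
    also have "\<dots> = z *s W f z"
      by (simp add: vec_eq_iff forall_2 matrix_vector_mult_def sum_2 mat_def)
    finally show ?thesis .
  qed (simp add: W_outside_disc)
  then have "Q (Q f) = W_adj (\<lambda>z. z *s W f z)"
    using form[OF Q[OF f]] by simp
  also have "\<dots> = (\<lambda>z. z\<^sup>2 * W_adj (W f) z)"
    by (simp add: W_adj_def fun_eq_iff algebra_simps)
  also have "\<dots> = (shift ^^ 2) f"
    by (simp add: W_adj_W[OF f] shift_def numeral_2_eq_2 fun_eq_iff mult.assoc)
  finally show ?thesis .
qed

theorem theorem2p4:
  fixes Q :: "(complex \<Rightarrow> complex) \<Rightarrow> (complex \<Rightarrow> complex)"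
  assumes "bounded_operator_H2 Q"
  shows "(\<forall>f\<in>H2. (Q ^^ 2) f = (shift ^^ 2) f) \<longleftrightarrow>
         (\<exists>U a b c.
            unitary_matrix U \<and> a \<in> Hinf \<and> b \<in> Hinf \<and> c \<in> Hinf \<and>
            (\<forall>z\<in>unit_disc. z * (a z)\<^sup>2 + b z * c z = 1) \<and>
            (\<forall>f\<in>H2. Q f =
               W_adj
                 (matrix_op (\<lambda>z. adjoint_matrix U)
                   (matrix_op (\<lambda>z. vector [vector [z * a z, b z], vector [z * c z, - (z * a z)]])
                     (matrix_op (\<lambda>z. U) (W f))))))"
  (is "?lhs \<longleftrightarrow> ?rhs")
proof
  assume ?lhs
  then have "Q (Q f) = (shift ^^ 2) f" if "f \<in> H2" for f
    using that by (simp add: numeral_2_eq_2)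
  then show ?rhs
    by (rule square_root_form[OF assms])
next
  assume ?rhs
  then obtain U a b c where U: "unitary_matrix U" and abc: "a \<in> Hinf" "b \<in> Hinf" "c \<in> Hinf"
    and id: "\<And>z. z \<in> unit_disc \<Longrightarrow> z * (a z)\<^sup>2 + b z * c z = 1"
    and Q: "\<And>f. f \<in> H2 \<Longrightarrow> Q f = W_adj (\<lambda>z. adjoint_matrix U *v
       (vector [vector [z * a z, b z], vector [z * c z, - (z * a z)]] *v (U *v W f z)))"
    unfolding matrix_op_def by blast
  define N :: "complex \<Rightarrow> complex^2^2" where
    "N = (\<lambda>z. vector [vector [z * a z, b z], vector [z * c z, - (z * a z)]])"
  define M where "M = (\<lambda>z. adjoint_matrix U ** N z ** U)"
  have N: "(\<lambda>z. N z $ i $ j) holomorphic_on unit_disc" for i j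
    using exhaust_2[of i] exhaust_2[of j]
    by (auto simp: N_def intro!: holomorphic_intros abc[THEN Hinf_D(1)])
  \<comment> \<open>The off-diagonal entries of the square cancel since \<open>N\<close> has trace
    zero; both diagonal entries are \<open>z\<close> times the left side of
    \<open>id\<close>.\<close>
  have N_sq: "N z ** N z = mat z" if "z \<in> unit_disc" for z
  proof -
    have "z * a z * (z * a z) + b z * (z * c z) = z * (z * (a z)\<^sup>2 + b z * c z)"
      by (simp add: algebra_simps power2_eq_square)
    also have "\<dots> = z" by (simp add: id[OF that])
    finally show ?thesis
      by (simp add: N_def vec_eq_iff forall_2 matrix_matrix_mult_def sum_2 mat_def algebra_simps)
  qed
  have "Q (Q f) = (shift ^^ 2) f" if "f \<in> H2" for f
  proof (rule square_eq_shift_square[OF _ _ _ _ that])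
    show "Q g \<in> H2" if "g \<in> H2" for g
      using assms that by (simp add: bounded_operator_H2_def)
    show "Q g = W_adj (\<lambda>z. M z *v W g z)" if "g \<in> H2" for g
      by (simp add: Q[OF that] M_def N_def matrix_vector_mul_assoc matrix_mul_assoc)
    show "(\<lambda>z. M z $ i $ j) holomorphic_on unit_disc" for i j
      unfolding M_def
      by (simp add: matrix_matrix_mult_def sum_2) (intro holomorphic_intros N)
    show "M z ** M z = mat z" if "z \<in> unit_disc" for z
    proof -
      \<comment> \<open>Unitary conjugation respects squares and fixes scalar matrices.\<close>
      have "M z ** M z = adjoint_matrix U ** N z ** (U ** adjoint_matrix U) ** N z ** U"
        by (simp add: M_def matrix_mul_assoc)
      also have "\<dots> = adjoint_matrix U ** (N z ** N z) ** U"
        using U by (simp add: unitary_matrix_def matrix_mul_assoc)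
      also have "\<dots> = adjoint_matrix U ** mat z ** U"
        by (simp add: N_sq[OF that])
      also have "adjoint_matrix U ** mat z = mat z ** adjoint_matrix U"
        by (simp add: vec_eq_iff forall_2 matrix_matrix_mult_def sum_2 mat_def)
      also have "mat z ** adjoint_matrix U ** U = mat z"
        using U by (simp add: unitary_matrix_def matrix_mul_assoc[symmetric])
      finally show ?thesis .
    qed
  qed
  then show ?lhs
    by (simp add: numeral_2_eq_2)
qed

end
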